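(* Let $0<m<\omega$ and let ${\cal I}$ be a collection of finite identities with ${\cal I}\subseteq{\cal I}(\aleph_m)$. Then $\mathrm{cl}({\cal I})\subseteq{\cal I}(\aleph_{m+1})$.
   Context: A (finite) identity is a structure $\langle A,E\rangle$, $A$ finite, $E$ an equivalence relation on $[A]^2$; the identity realized by (or represented by) a coloring $c:[G]^2\to\omega$ with $G$ finite is $\langle G,E_c\rangle$ where $\{x,y\}E_c\{u,v\}$ iff $c(\{x,y\})=c(\{u,v\})$. A coloring $f:[B]^2\to\omega$ realizes $\langle A,E\rangle$ if there is a one-to-one $k:A\to B$ such that $\{x,y\}E\{u,v\}$ implies $f(\{k(x),k(y)\})=f(\{k(u),k(v)\})$. ${\cal I}(\kappa)$ is the collection of finite identities realized by every $f:[\kappa]^2\to\omega$. End-homogeneous amalgam: given a finite sequence of identities $\langle J_i:1\le i\le n\rangle$, choose colorings $c_i:[G_i]^2\to\omega$ representing $J_i$ with the $G_i$ pairwise disjoint and the ranges $\mathrm{rng}(c_i)$ pairwise disjoint. Let $G=\bigcup_i G_i$ and choose $c:[G]^2\to\omega$ such that for all $i$ and all $\{r,s\},\{t,v\}\in[G]^2$: (1) $c\supseteq c_i$; (2) $c(\{r,s\})\in\mathrm{rng}(c_i)$ iff $\{r,s\}\in\mathrm{dom}(c_i)$; (3) if $\{r,s\},\{t,v\}\notin\bigcup_j\mathrm{dom}(c_j)$ then $c(\{r,s\})=c(\{t,v\})$ iff $\min\{j:r\in G_j\vee s\in G_j\}=\min\{j:t\in G_j\vee v\in G_j\}$. The end-homogeneous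 amalgam of the sequence is the identity represented by $c$. For a collection ${\cal I}$ of identities, $\mathrm{cl}({\cal I})$ is the collection of all end-homogeneous amalgams of all finite sequences of identities from ${\cal I}$. *)

theory Defs
  imports Main "HOL-Library.Ramsey" "HOL-Library.Disjoint_Sets"
begin

unbundle cardinal_syntax

text \<open>
  Alephs are represented by cardinal orders. Since \<open>cardSuc\<close> raises the type, the \<open>m\<close>-th aleph
  cannot be a single function of \<open>m\<close>; instead \<open>is_aleph m \<kappa>\<close> says that the relation \<open>\<kappa>\<close>, on any
  sufficiently large type, has the order type of the cardinal \<open>\<aleph>\<^sub>m\<close>. Taking the predecessor
  cardinal on the same type is harmless: every set of size \<open>\<aleph>\<^sub>m\<^sub>+\<^sub>1\<close> has a subset of size \<open>\<aleph>\<^sub>m\<close>.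
\<close>

primrec is_aleph :: "nat \<Rightarrow> 'k rel \<Rightarrow> bool" where
  "is_aleph 0 \<kappa> \<longleftrightarrow> \<kappa> =o natLeq"
| "is_aleph (Suc m) \<kappa> \<longleftrightarrow> (\<exists>\<mu> :: 'k rel. is_aleph m \<mu> \<and> \<kappa> =o cardSuc \<mu>)"

text \<open>
  A structure \<open>(A, E)\<close>, where \<open>E\<close> relates two-element subsets of \<open>A\<close>.
  A coloring of \<open>[B]\<^sup>2\<close> is a function on all sets of which only the values
  on \<open>[B]\<^sup>2\<close> are ever used.
\<close>

type_synonym 'a identity = "'a set \<times> ('a set \<times> 'a set) set"

definition finite_identity :: "'a identity \<Rightarrow> bool" where
  "finite_identity J \<longleftrightarrow> (case J of (A, E) \<Rightarrow> finite A \<and> equiv ([A]\<^bsup>2\<^esup>) E)"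

definition coloring_identity :: "'a set \<Rightarrow> ('a set \<Rightarrow> nat) \<Rightarrow> 'a identity" where
  "coloring_identity G c = (G, {(p, q). p \<in> [G]\<^bsup>2\<^esup> \<and> q \<in> [G]\<^bsup>2\<^esup> \<and> c p = c q})"

definition identity_iso :: "'a identity \<Rightarrow> 'b identity \<Rightarrow> bool" where
  "identity_iso J K \<longleftrightarrow> (case J of (A, E) \<Rightarrow> case K of (B, F) \<Rightarrow>
     (\<exists>k. bij_betw k A B \<and>
        (\<forall>p \<in> [A]\<^bsup>2\<^esup>. \<forall>q \<in> [A]\<^bsup>2\<^esup>. (p, q) \<in> E \<longleftrightarrow> (k ` p, k ` q) \<in> F)))"

text \<open>
  Representation is up to isomorphism: this is what allows the same identity to be
  represented on several pairwise disjoint sets.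
\<close>

definition represents :: "'b set \<Rightarrow> ('b set \<Rightarrow> nat) \<Rightarrow> 'a identity \<Rightarrow> bool" where
  "represents G c J \<longleftrightarrow> finite G \<and> identity_iso J (coloring_identity G c)"

definition realizes :: "'b set \<Rightarrow> ('b set \<Rightarrow> nat) \<Rightarrow> 'a identity \<Rightarrow> bool" where
  "realizes B f J \<longleftrightarrow> (case J of (A, E) \<Rightarrow>
     (\<exists>k. inj_on k A \<and> k ` A \<subseteq> B \<and>
        (\<forall>x y u v. ({x, y}, {u, v}) \<in> E \<longrightarrow> f {k x, k y} = f {k u, k v})))"

definition identities_of :: "'k rel \<Rightarrow> 'a identity set" where
  "identities_of \<kappa> = {J. finite_identity J \<and> (\<forall>f. realizes (Field \<kappa>) f J)}"

text \<open>
  Condition (3) is stated for pairs \<open>p = {r, s}\<close>, for which \<open>r \<in> G j \<or> s \<in> G j\<close> reads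
  \<open>p \<inter> G j \<noteq> {}\<close>.
\<close>

definition end_homogeneous_amalgam :: "nat \<Rightarrow> (nat \<Rightarrow> 'a identity) \<Rightarrow> 'b identity \<Rightarrow> bool" where
  "end_homogeneous_amalgam n J K \<longleftrightarrow>
     (\<exists>(G :: nat \<Rightarrow> 'b set) (d :: nat \<Rightarrow> 'b set \<Rightarrow> nat) (c :: 'b set \<Rightarrow> nat).
        (\<forall>i \<in> {1..n}. represents (G i) (d i) (J i)) \<and>
        disjoint_family_on G {1..n} \<and>
        disjoint_family_on (\<lambda>i. d i ` [G i]\<^bsup>2\<^esup>) {1..n} \<and>
        (let U = (\<Union>i \<in> {1..n}. G i);
             inner = (\<Union>j \<in> {1..n}. [G j]\<^bsup>2\<^esup>);
             first = (\<lambda>p. Min {j \<in> {1..n}. p \<inter> G j \<noteq> {}})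
         in (\<forall>i \<in> {1..n}. \<forall>p \<in> [G i]\<^bsup>2\<^esup>. c p = d i p) \<and>
            (\<forall>i \<in> {1..n}. \<forall>p \<in> [U]\<^bsup>2\<^esup>. c p \<in> d i ` [G i]\<^bsup>2\<^esup> \<longleftrightarrow> p \<in> [G i]\<^bsup>2\<^esup>) \<and>
            (\<forall>p \<in> [U]\<^bsup>2\<^esup> - inner. \<forall>q \<in> [U]\<^bsup>2\<^esup> - inner. c p = c q \<longleftrightarrow> first p = first q) \<and>
            K = coloring_identity U c))"

text \<open>
  The closure may live on a different carrier type, so that a small type for the given
  identities does not restrict the amalgams.
\<close>

definition cl :: "'a identity set \<Rightarrow> 'b identity set" where
  "cl \<I> = {K. \<exists>n J. (\<forall>i \<in> {1..n}. J i \<in> \<I>) \<and> end_homogeneous_amalgam n J K}"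

end

theory Submission
  imports Defs
begin

text \<open>
  Let \<open>\<kappa> = \<aleph>\<^sub>m\<close> and color the pairs of a set \<open>B\<close> of size \<open>\<kappa>\<^sup>+\<close>. Fix \<open>A \<subseteq> B\<close> of size \<open>\<kappa>\<close>. As \<open>\<kappa>\<close> is an
  uncountable successor, every \<open>b \<in> B - A\<close> sees \<open>\<kappa>\<close> many points of \<open>A\<close> in one color, and these
  contain a copy of \<open>J\<^sub>1\<close>. There are only \<open>\<kappa>\<close> many pairs of a finite tuple of \<open>A\<close> and a color, so
  \<open>\<kappa>\<^sup>+\<close> many \<open>b\<close> see the same copy in the same color. Continue with \<open>J\<^sub>2\<close> inside the set of these \<open>b\<close>.
\<close>

section \<open>Cardinals\<close>

lemma card_of_not_ordLeq:
  assumes "Card_order r"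
  shows "\<not> |A| \<le>o r \<longleftrightarrow> r <o |A|"
  by (rule not_ordLeq_iff_ordLess[OF card_order_on_well_order_on[OF assms] card_of_Well_order])

text \<open>Colors are natural numbers, so this bounds the number of color classes in every later
  pigeonhole argument.\<close>

lemma infinite_Field_nat_ordLeq:
  assumes "Card_order r" "infinite (Field r)"
  shows "|UNIV :: nat set| \<le>o r"
  by (rule ordLeq_ordIso_trans[OF iffD1[OF infinite_iff_card_of_nat assms(2)] card_of_Field_ordIso[OF assms(1)]])

section \<open>Pigeonhole principles above an infinite cardinal\<close>

text \<open>If all fibres had size at most \<open>\<nu>\<close>, then \<open>A\<close> would be a
  union of at most \<open>\<nu>\<close> of them and hence no larger than \<open>\<nu>\<close>. In
  effect, this is the regularity of the successor of \<open>\<nu>\<close>.\<close>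

lemma pigeonhole_ordLess:
  assumes \<nu>: "Card_order \<nu>" "infinite (Field \<nu>)"
    and A: "\<nu> <o |A|" and S: "|S| \<le>o \<nu>" and g: "g ` A \<subseteq> S"
  obtains s where "\<nu> <o |{a \<in> A. g a = s}|"
proof -
  have "\<exists>s. \<not> |{a \<in> A. g a = s}| \<le>o \<nu>"
  proof (rule ccontr)
    assume "\<not> ?thesis"
    then have "\<forall>s\<in>S. |{a \<in> A. g a = s}| \<le>o \<nu>"
      by blast
    then have "|\<Union>s\<in>S. {a \<in> A. g a = s}| \<le>o \<nu>"
      by (rule card_of_UNION_ordLeq_infinite_Field[OF \<nu>(2,1) S])
    moreover have "(\<Union>s\<in>S. {a \<in> A. g a = s}) = A"
      using g by auto
    ultimately show False
      using not_ordLess_ordLeq[OF A] by simp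
  qed
  then show thesis
    using that unfolding card_of_not_ordLeq[OF \<nu>(1)] by (elim exE)
qed

text \<open>Induction on \<open>G\<close> freezes one coordinate of the tuple at a time, each time
  passing to a still large subset, so the set of all tuples never has to be counted. It serves to
  make many copies of a finite identity coincide.\<close>

lemma pigeonhole_finite_tuple:
  assumes "finite G"
    and \<nu>: "Card_order \<nu>" "infinite (Field \<nu>)" and S: "|S| \<le>o \<nu>"
    and A: "\<nu> <o |A|" and g: "\<And>a x. a \<in> A \<Longrightarrow> x \<in> G \<Longrightarrow> g a x \<in> S"
  obtains C t where "C \<subseteq> A" "\<nu> <o |C|" "\<And>a x. a \<in> C \<Longrightarrow> x \<in> G \<Longrightarrow> g a x = t x"
  using assms(1) A g
proof (induction G arbitrary: thesis)
  case empty
  show ?case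
    by (rule empty(1)[of A]) (use A in auto)
next
  case (insert y G)
  obtain C t where C: "C \<subseteq> A" "\<nu> <o |C|" and t: "\<And>a x. a \<in> C \<Longrightarrow> x \<in> G \<Longrightarrow> g a x = t x"
    by (rule insert.IH) (use insert.prems in auto)
  have "(\<lambda>a. g a y) ` C \<subseteq> S"
    using C(1) insert.prems(3) by blast
  then obtain s where "\<nu> <o |{a \<in> C. g a y = s}|"
    by (rule pigeonhole_ordLess[OF \<nu> C(2) S])
  then show ?case
    by (intro insert.prems(1)[of "{a \<in> C. g a y = s}" "t(y := s)"]) (use C(1) t in auto)
qed

section \<open>Alephs on different carrier types\<close>

lemma is_aleph_Card_order:
  fixes \<kappa> :: "'k rel"
  assumes "is_aleph m \<kappa>"
  shows "Card_order \<kappa>"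
  using assms
proof (induction m arbitrary: \<kappa>)
  case 0
  then show ?case
    using Card_order_ordIso[OF natLeq_Card_order] by simp
next
  case (Suc m)
  then obtain \<mu> :: "'k rel" where \<mu>: "is_aleph m \<mu>" "\<kappa> =o cardSuc \<mu>"
    unfolding is_aleph.simps by (elim exE conjE)
  show ?case
    by (rule Card_order_ordIso[OF cardSuc_Card_order[OF Suc.IH[OF \<mu>(1)]] \<mu>(2)])
qed

lemma infinite_Field_ordIso_cardSuc:
  assumes "Card_order \<nu>" "infinite (Field \<nu>)" "\<mu> =o cardSuc \<nu>"
  shows "infinite (Field \<mu>)"
  using cardSuc_finite[OF assms(1)] card_of_ordIso_finite[OF card_of_cong[OF assms(3)]] assms(2)
  by simp

lemma is_aleph_infinite_Field:
  fixes \<kappa> :: "'k rel"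
  assumes "is_aleph m \<kappa>"
  shows "infinite (Field \<kappa>)"
  using assms
proof (induction m arbitrary: \<kappa>)
  case 0
  then have "\<kappa> =o natLeq"
    by simp
  from card_of_ordIso_finite[OF card_of_cong[OF this]] show ?case
    by (simp add: Field_natLeq)
next
  case (Suc m)
  then obtain \<mu> :: "'k rel" where \<mu>: "is_aleph m \<mu>" "\<kappa> =o cardSuc \<mu>"
    unfolding is_aleph.simps by (elim exE conjE)
  show ?case
    by (rule infinite_Field_ordIso_cardSuc[OF is_aleph_Card_order[OF \<mu>(1)] Suc.IH[OF \<mu>(1)] \<mu>(2)])
qed

text \<open>Successor cardinals respect order isomorphism, so the chains of predecessors can be
  compared from \<open>natLeq\<close> upwards. This carries the hypothesis about one carrier type
  over to another.\<close>

lemma is_aleph_unique: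
  fixes \<kappa> :: "'k rel" and \<mu> :: "'l rel"
  assumes "is_aleph m \<kappa>" "is_aleph m \<mu>"
  shows "\<kappa> =o \<mu>"
  using assms
proof (induction m arbitrary: \<kappa> \<mu>)
  case 0
  then show ?case
    using ordIso_transitive[OF _ ordIso_symmetric] by simp
next
  case (Suc m)
  obtain \<kappa>1 :: "'k rel" where \<kappa>1: "is_aleph m \<kappa>1" "\<kappa> =o cardSuc \<kappa>1"
    using Suc.prems(1) unfolding is_aleph.simps by (elim exE conjE)
  obtain \<mu>1 :: "'l rel" where \<mu>1: "is_aleph m \<mu>1" "\<mu> =o cardSuc \<mu>1"
    using Suc.prems(2) unfolding is_aleph.simps by (elim exE conjE)
  have "cardSuc \<kappa>1 =o cardSuc \<mu>1"
    using Suc.IH[OF \<kappa>1(1) \<mu>1(1)]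
      cardSuc_invar_ordIso[OF is_aleph_Card_order[OF \<kappa>1(1)] is_aleph_Card_order[OF \<mu>1(1)]]
    by simp
  from ordIso_transitive[OF \<kappa>1(2) ordIso_transitive[OF this ordIso_symmetric[OF \<mu>1(2)]]]
  show ?case .
qed

section \<open>Color-preserving embeddings\<close>

text \<open>The counterpart of \<open>realizes\<close> for an identity given by a coloring. As
  there, equal colors must stay equal, while different colors may merge.\<close>

definition color_embedding :: "'a set \<Rightarrow> ('a set \<Rightarrow> 'c) \<Rightarrow> 'b set \<Rightarrow> ('b set \<Rightarrow> 'd) \<Rightarrow> ('a \<Rightarrow> 'b) \<Rightarrow> bool"
  where "color_embedding G c B f h \<longleftrightarrow> inj_on h G \<and> h ` G \<subseteq> B \<and>
    (\<forall>p \<in> [G]\<^bsup>2\<^esup>. \<forall>q \<in> [G]\<^bsup>2\<^esup>. c p = c q \<longrightarrow> f (h ` p) = f (h ` q))"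

lemma color_embedding_cong:
  assumes "\<And>x. x \<in> G \<Longrightarrow> h x = h' x"
  shows "color_embedding G c B f h \<longleftrightarrow> color_embedding G c B f h'"
proof -
  have "h ` p = h' ` p" if "p \<in> [G]\<^bsup>2\<^esup>" for p
    using that assms by (intro image_cong) (auto simp: nsets_def)
  moreover have "inj_on h G = inj_on h' G"
    using assms by (rule inj_on_cong)
  moreover have "h ` G = h' ` G"
    using assms by (intro image_cong) auto
  ultimately show ?thesis
    by (simp add: color_embedding_def)
qed

lemma color_embedding_mono:
  "color_embedding G c B f h \<Longrightarrow> B \<subseteq> C \<Longrightarrow> color_embedding G c C f h"
  unfolding color_embedding_def by (meson subset_trans)

lemma realizes_coloring_identityI:
  assumes "color_embedding G c B f h"
  shows "realizes B f (coloring_identity G c)"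
proof -
  have "f {h x, h y} = f {h u, h v}"
    if "{x, y} \<in> [G]\<^bsup>2\<^esup>" "{u, v} \<in> [G]\<^bsup>2\<^esup>" "c {x, y} = c {u, v}" for x y u v
    using assms that unfolding color_embedding_def by (metis image_empty image_insert)
  then have "\<forall>x y u v. ({x, y}, {u, v}) \<in> snd (coloring_identity G c) \<longrightarrow> f {h x, h y} = f {h u, h v}"
    unfolding coloring_identity_def by simp
  then show ?thesis
    using assms unfolding realizes_def coloring_identity_def color_embedding_def split_def fst_conv snd_conv
    by blast
qed

text \<open>Compose a realization of \<open>J\<close> with the inverse of the isomorphism from
  \<open>J\<close> onto the identity of \<open>d\<close>. Amalgams are built on the sets
  \<open>G i\<close>, whereas the hypotheses only provide realizations of the
  \<open>J i\<close>.\<close>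

lemma represents_color_embedding:
  assumes "represents G d J" and "realizes B f J"
  obtains h where "color_embedding G d B f h"
proof -
  obtain A E where J: "J = (A, E)"
    by fastforce
  obtain k where k: "bij_betw k A G"
    and kE: "\<And>p q. p \<in> [A]\<^bsup>2\<^esup> \<Longrightarrow> q \<in> [A]\<^bsup>2\<^esup> \<Longrightarrow>
        (p, q) \<in> E \<longleftrightarrow> k ` p \<in> [G]\<^bsup>2\<^esup> \<and> k ` q \<in> [G]\<^bsup>2\<^esup> \<and> d (k ` p) = d (k ` q)"
    using assms(1) unfolding represents_def identity_iso_def coloring_identity_def J by auto
  obtain l where l: "inj_on l A" "l ` A \<subseteq> B"
    and lE: "\<And>x y u v. ({x, y}, {u, v}) \<in> E \<Longrightarrow> f {l x, l y} = f {l u, l v}"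
    using assms(2) unfolding realizes_def J by auto
  define j where "j = inv_into A k"
  have j: "bij_betw j G A"
    unfolding j_def by (rule bij_betw_inv_into[OF k])
  have kj: "k (j x) = x" if "x \<in> G" for x
    unfolding j_def using k that by (simp add: bij_betw_inv_into_right)
  have "f ((l \<circ> j) ` p) = f ((l \<circ> j) ` q)"
    if p: "p \<in> [G]\<^bsup>2\<^esup>" and q: "q \<in> [G]\<^bsup>2\<^esup>" and eq: "d p = d q" for p q
  proof -
    obtain x y where xy: "p = {x, y}" "x \<in> G" "y \<in> G" "x \<noteq> y"
      using p by (auto simp: nsets_def card_2_iff)
    obtain u v where uv: "q = {u, v}" "u \<in> G" "v \<in> G" "u \<noteq> v"
      using q by (auto simp: nsets_def card_2_iff)
    have "{j x, j y} \<in> [A]\<^bsup>2\<^esup>" "{j u, j v} \<in> [A]\<^bsup>2\<^esup>"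
      using j xy uv kj by (auto simp: nsets_def card_2_iff bij_betw_def) metis+
    then have "({j x, j y}, {j u, j v}) \<in> E"
      using kE p q eq xy uv kj by simp
    from lE[OF this] show ?thesis
      using xy uv by simp
  qed
  moreover have "inj_on (l \<circ> j) G" "(l \<circ> j) ` G \<subseteq> B"
    using j l by (auto simp: bij_betw_def intro!: comp_inj_on)
  ultimately show thesis
    using that unfolding color_embedding_def by blast
qed

text \<open>Pull \<open>f\<close> back to \<open>Field \<kappa>\<close> along an injection
  \<open>\<phi>\<close> into \<open>B\<close>, and push the realization found there forward
  again.\<close>

lemma identities_of_realizes:
  assumes "J \<in> identities_of \<kappa>" and "|Field \<kappa>| \<le>o |B|"
  shows "realizes B f J"
proof -
  obtain A E where J: "J = (A, E)"
    by fastforce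
  obtain \<phi> where \<phi>: "inj_on \<phi> (Field \<kappa>)" "\<phi> ` Field \<kappa> \<subseteq> B"
    using iffD2[OF card_of_ordLeq assms(2)] by (elim exE conjE)
  have "realizes (Field \<kappa>) (\<lambda>p. f (\<phi> ` p)) J"
    using assms(1) unfolding identities_of_def by blast
  then obtain k where "inj_on k A" "k ` A \<subseteq> Field \<kappa>"
    and "\<And>x y u v. ({x, y}, {u, v}) \<in> E \<Longrightarrow> f {\<phi> (k x), \<phi> (k y)} = f {\<phi> (k u), \<phi> (k v)}"
    unfolding realizes_def J by auto
  moreover from this have "inj_on (\<phi> \<circ> k) A"
    using \<phi>(1) by (blast intro: comp_inj_on inj_on_subset)
  moreover have "(\<phi> \<circ> k) ` A \<subseteq> B"
    using \<open>k ` A \<subseteq> Field \<kappa>\<close> \<phi>(2) by fastforce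
  ultimately show ?thesis
    unfolding realizes_def J by (auto intro!: exI[of _ "\<phi> \<circ> k"])
qed

section \<open>End-homogeneous embeddings\<close>

text \<open>One round of the construction. That \<open>\<mu>\<close> is the successor of an infinite
  \<open>\<nu>\<close> matters because countably many color classes cannot all have size at most
  \<open>\<nu>\<close> in a set of size \<open>\<mu>\<close>.\<close>

lemma end_homogeneous_step:
  fixes f :: "'b set \<Rightarrow> nat"
  assumes \<nu>: "Card_order \<nu>" "infinite (Field \<nu>)" and \<mu>: "\<mu> =o cardSuc \<nu>"
    and B: "\<mu> <o |B|" and G: "finite G"
    and emb: "\<And>X. X \<subseteq> B \<Longrightarrow> \<mu> \<le>o |X| \<Longrightarrow> \<exists>h. color_embedding G d X f h"
  obtains h e B' where "color_embedding G d B f h" "B' \<subseteq> B - h ` G" "\<mu> <o |B'|"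
    "\<And>x b. x \<in> G \<Longrightarrow> b \<in> B' \<Longrightarrow> f {h x, b} = e"
proof -
  have co: "Card_order \<mu>"
    by (rule Card_order_ordIso[OF cardSuc_Card_order[OF \<nu>(1)] \<mu>])
  have inf: "infinite (Field \<mu>)"
    by (rule infinite_Field_ordIso_cardSuc[OF \<nu> \<mu>])
  have "|Field \<mu>| \<le>o |B|"
    by (rule ordIso_ordLeq_trans[OF card_of_Field_ordIso[OF co] ordLess_imp_ordLeq[OF B]])
  \<comment> \<open>\<open>A\<close> has size exactly \<open>\<mu>\<close>: large enough to keep a
    color class of size \<open>\<mu>\<close>, and small enough that points of \<open>A\<close> can
    serve as pigeonholes for more than \<open>\<mu>\<close> many \<open>b\<close>.\<close>
  from iffD1[OF internalize_card_of_ordLeq2 this]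
  obtain A where A: "A \<subseteq> B" "|Field \<mu>| =o |A|"
    by (elim exE conjE)
  have A\<mu>: "|A| =o \<mu>"
    by (rule ordIso_transitive[OF ordIso_symmetric[OF A(2)] card_of_Field_ordIso[OF co]])
  have BA: "\<mu> <o |B - A|"
  proof -
    have "\<not> |B - A| \<le>o \<mu>"
    proof
      assume "|B - A| \<le>o \<mu>"
      then have "|A \<union> (B - A)| \<le>o \<mu>"
        by (rule card_of_Un_ordLeq_infinite_Field[OF inf ordIso_imp_ordLeq[OF A\<mu>] _ co])
      moreover have "A \<union> (B - A) = B"
        using A(1) by blast
      ultimately show False
        using not_ordLess_ordLeq[OF B] by simp
    qed
    then show ?thesis
      by (simp add: card_of_not_ordLeq[OF co])
  qed
  \<comment> \<open>\<open>b\<close> is arbitrary here, possibly in \<open>A\<close>, where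
    \<open>{a, b}\<close> may be a singleton. This is harmless since \<open>f\<close> is total, and
    below only points of \<open>B - A\<close> are selected.\<close>
  have "\<exists>h e. color_embedding G d {a \<in> A. f {a, b} = e} f h" for b
  proof -
    have "\<nu> <o |A|"
      by (rule ordLess_ordIso_trans[OF cardSuc_greater[OF \<nu>(1)]
            ordIso_symmetric[OF ordIso_transitive[OF A\<mu> \<mu>]]])
    then obtain e where "\<nu> <o |{a \<in> A. f {a, b} = e}|"
      by (rule pigeonhole_ordLess[OF \<nu> _ infinite_Field_nat_ordLeq[OF \<nu>]]) auto
    then have "\<mu> \<le>o |{a \<in> A. f {a, b} = e}|"
      by (rule ordIso_ordLeq_trans[OF \<mu> iffD1[OF cardSuc_ordLess_ordLeq[OF \<nu>(1) card_of_Card_order]]])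
    moreover have "{a \<in> A. f {a, b} = e} \<subseteq> B"
      using A(1) by blast
    ultimately show ?thesis
      using emb by blast
  qed
  then obtain h e where he: "\<And>b. color_embedding G d {a \<in> A. f {a, b} = e b} f (h b)"
    by metis
  \<comment> \<open>Two thinnings of \<open>B - A\<close>: first the color \<open>e b\<close> is
    made constant, then the copy \<open>h b\<close>, point by point. Color and points come from sets
    of size at most \<open>\<mu>\<close>.\<close>
  obtain a where a: "\<mu> <o |{b \<in> B - A. e b = a}|"
    by (rule pigeonhole_ordLess[OF co inf BA infinite_Field_nat_ordLeq[OF co inf]]) auto
  have hA: "h b x \<in> A" if "b \<in> {b \<in> B - A. e b = a}" "x \<in> G" for b x
    using he[of b] that(2) by (auto simp: color_embedding_def)
  obtain C t where C: "C \<subseteq> {b \<in> B - A. e b = a}" "\<mu> <o |C|"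
    and t: "\<And>b x. b \<in> C \<Longrightarrow> x \<in> G \<Longrightarrow> h b x = t x"
    by (rule pigeonhole_finite_tuple[where g = h, OF G co inf ordIso_imp_ordLeq[OF A\<mu>] a hA];
        (assumption | (rule that; (assumption | simp))))
  \<comment> \<open>Some \<open>b\<close> in \<open>C\<close> is needed to certify that
    \<open>t\<close> is an embedding, since \<open>t\<close> is known only as the common value of
    the \<open>h b\<close> on \<open>G\<close>.\<close>
  have "C \<noteq> {}"
  proof
    assume "C = {}"
    then have "|C| \<le>o \<mu>"
      using card_of_empty1[OF disjI2[OF co]] by (simp only:)
    then show False
      by (rule notE[OF not_ordLess_ordLeq[OF C(2)]])
  qed
  have emb_t: "color_embedding G d {a' \<in> A. f {a', b} = a} f t" if "b \<in> C" for b
    using he[of b] color_embedding_cong[of G "h b" t, OF t[OF that]] C(1) that by auto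
  show thesis
  proof (rule that)
    show "color_embedding G d B f t"
      using \<open>C \<noteq> {}\<close> emb_t A(1) by (blast intro: color_embedding_mono)
    \<comment> \<open>The copy lies in \<open>A\<close>, and \<open>C\<close> was chosen outside
      \<open>A\<close>.\<close>
    show "C \<subseteq> B - t ` G"
      using C(1) emb_t by (fastforce simp: color_embedding_def)
    show "f {t x, b} = a" if "x \<in> G" "b \<in> C" for x b
      using emb_t[OF that(2)] that(1) by (auto simp: color_embedding_def)
  qed (rule C(2))
qed

text \<open>Iterates the step inside a shrinking reservoir \<open>C\<close>, which stays large,
  avoids all earlier copies and sees copy \<open>i\<close> in the single color \<open>e i\<close>.
  Copies are chosen in increasing order, so a pair across two copies takes its color from the
  smaller index, as the \<open>Min\<close> in the amalgam requires.\<close>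

lemma end_homogeneous_sequence:
  fixes f :: "'b set \<Rightarrow> nat" and n :: nat
  assumes \<nu>: "Card_order \<nu>" "infinite (Field \<nu>)" and \<mu>: "\<mu> =o cardSuc \<nu>"
    and B: "\<mu> <o |B|" and G: "\<And>i. i \<in> {1..n} \<Longrightarrow> finite (G i)"
    and emb: "\<And>i X. i \<in> {1..n} \<Longrightarrow> \<mu> \<le>o |X| \<Longrightarrow> \<exists>h. color_embedding (G i) (d i) X f h"
  obtains h e C where "C \<subseteq> B" "\<mu> <o |C|"
    "\<And>i. i \<in> {1..n} \<Longrightarrow> color_embedding (G i) (d i) B f (h i)"
    "\<And>i. i \<in> {1..n} \<Longrightarrow> C \<inter> h i ` G i = {}"
    "\<And>i x b. i \<in> {1..n} \<Longrightarrow> x \<in> G i \<Longrightarrow> b \<in> C \<Longrightarrow> f {h i x, b} = e i"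
    "\<And>i j x y. 1 \<le> i \<Longrightarrow> i < j \<Longrightarrow> j \<le> n \<Longrightarrow> x \<in> G i \<Longrightarrow> y \<in> G j \<Longrightarrow>
      h i x \<noteq> h j y \<and> f {h i x, h j y} = e i"
  using assms(5,6)
proof (induction n arbitrary: thesis)
  case 0
  show ?case
    by (rule 0(1)[of B]) (use B in auto)
next
  case (Suc n)
  obtain h e C where C: "C \<subseteq> B" "\<mu> <o |C|"
    and h: "\<And>i. i \<in> {1..n} \<Longrightarrow> color_embedding (G i) (d i) B f (h i)"
    and disj: "\<And>i. i \<in> {1..n} \<Longrightarrow> C \<inter> h i ` G i = {}"
    and e: "\<And>i x b. i \<in> {1..n} \<Longrightarrow> x \<in> G i \<Longrightarrow> b \<in> C \<Longrightarrow> f {h i x, b} = e i"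
    and cross: "\<And>i j x y. 1 \<le> i \<Longrightarrow> i < j \<Longrightarrow> j \<le> n \<Longrightarrow> x \<in> G i \<Longrightarrow> y \<in> G j \<Longrightarrow>
      h i x \<noteq> h j y \<and> f {h i x, h j y} = e i"
    by (rule Suc.IH) (use Suc.prems in auto)
  obtain k a D where k: "color_embedding (G (Suc n)) (d (Suc n)) C f k"
    and D: "D \<subseteq> C - k ` G (Suc n)" "\<mu> <o |D|"
    and a: "\<And>x b. x \<in> G (Suc n) \<Longrightarrow> b \<in> D \<Longrightarrow> f {k x, b} = a"
    by (rule end_homogeneous_step[OF \<nu> \<mu> C(2), of "G (Suc n)" "d (Suc n)" f])
      (use Suc.prems in auto)
  have kC: "k y \<in> C" if "y \<in> G (Suc n)" for y
    using k that by (auto simp: color_embedding_def)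
  show ?case
  proof (rule Suc.prems(1)[of D "h(Suc n := k)" "e(Suc n := a)"])
    show "D \<subseteq> B"
      using D C by blast
    show "\<mu> <o |D|"
      by (rule D)
    show "color_embedding (G i) (d i) B f ((h(Suc n := k)) i)" if "i \<in> {1..Suc n}" for i
      using that h[of i] color_embedding_mono[OF k C(1)] by (cases "i = Suc n") auto
    show "D \<inter> (h(Suc n := k)) i ` G i = {}" if "i \<in> {1..Suc n}" for i
      using that D(1) disj[of i] by (cases "i = Suc n") auto
    show "f {(h(Suc n := k)) i x, b} = (e(Suc n := a)) i"
      if "i \<in> {1..Suc n}" "x \<in> G i" "b \<in> D" for i x b
      using that D(1) e[of i x b] a by (cases "i = Suc n") auto
    show "(h(Suc n := k)) i x \<noteq> (h(Suc n := k)) j y \<and>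
        f {(h(Suc n := k)) i x, (h(Suc n := k)) j y} = (e(Suc n := a)) i"
      if "1 \<le> i" "i < j" "j \<le> Suc n" "x \<in> G i" "y \<in> G j" for i j x y
    \<comment> \<open>Only pairs ending in the new copy are new. That copy lies in the old reservoir
      \<open>C\<close>, so the invariants of \<open>C\<close> give both distinctness and the
      color.\<close>
    proof (cases "j = Suc n")
      case True
      then have "k y \<in> C"
        using that(5) kC by simp
      moreover have i: "i \<in> {1..n}"
        using that(1,2) True by simp
      moreover have "k y \<notin> h i ` G i"
        using disj[OF i] \<open>k y \<in> C\<close> by (meson disjoint_iff)
      then have "h i x \<noteq> k y"
        using that(4) by (metis imageI)
      ultimately show ?thesis
        using that True e[of i x "k y"] by simp
    next
      case False
      then show ?thesis
        using that cross[of i j x y] by auto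
    qed
  qed
qed

section \<open>Gluing the copies into a realization of the amalgam\<close>

text \<open>Two pairs of equal color in the amalgam either lie in the same \<open>G i\<close>, where
  the \<open>i\<close>-th embedding preserves the equality, or both cross between parts with the
  same least index \<open>i\<close>, and then both images have color \<open>e i\<close>.\<close>

lemma end_homogeneous_amalgam_realizes:
  fixes f :: "'l set \<Rightarrow> nat" and J :: "nat \<Rightarrow> 'a identity" and K :: "'b identity"
  assumes \<nu>: "Card_order \<nu>" "infinite (Field \<nu>)" and \<mu>: "\<mu> =o cardSuc \<nu>"
    and B: "\<mu> <o |B|"
    and J: "\<And>i X. i \<in> {1..n} \<Longrightarrow> \<mu> \<le>o |X| \<Longrightarrow> realizes X f (J i)"
    and K: "end_homogeneous_amalgam n J K"
  shows "realizes B f K"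
proof -
  obtain G :: "nat \<Rightarrow> 'b set" and d c where
    rep: "\<And>i. i \<in> {1..n} \<Longrightarrow> represents (G i) (d i) (J i)"
    and disj: "disjoint_family_on G {1..n}"
    and cd: "\<And>i p. i \<in> {1..n} \<Longrightarrow> p \<in> [G i]\<^bsup>2\<^esup> \<Longrightarrow> c p = d i p"
    and rng: "\<And>i p. i \<in> {1..n} \<Longrightarrow> p \<in> [\<Union>i \<in> {1..n}. G i]\<^bsup>2\<^esup> \<Longrightarrow>
      c p \<in> d i ` [G i]\<^bsup>2\<^esup> \<longleftrightarrow> p \<in> [G i]\<^bsup>2\<^esup>"
    and outer: "\<And>p q. p \<in> [\<Union>i \<in> {1..n}. G i]\<^bsup>2\<^esup> - (\<Union>j \<in> {1..n}. [G j]\<^bsup>2\<^esup>) \<Longrightarrow>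
      q \<in> [\<Union>i \<in> {1..n}. G i]\<^bsup>2\<^esup> - (\<Union>j \<in> {1..n}. [G j]\<^bsup>2\<^esup>) \<Longrightarrow>
      c p = c q \<longleftrightarrow> Min {j \<in> {1..n}. p \<inter> G j \<noteq> {}} = Min {j \<in> {1..n}. q \<inter> G j \<noteq> {}}"
    and K_eq: "K = coloring_identity (\<Union>i \<in> {1..n}. G i) c"
    using K unfolding end_homogeneous_amalgam_def Let_def by blast
  let ?U = "\<Union>i \<in> {1..n}. G i"
  have unique: "i = j" if "i \<in> {1..n}" "j \<in> {1..n}" "x \<in> G i" "x \<in> G j" for i j x
    using disj that unfolding disjoint_family_on_def by blast
  have fin: "finite (G i)" if "i \<in> {1..n}" for i
    using rep[OF that] by (simp add: represents_def)
  have emb: "\<exists>h. color_embedding (G i) (d i) X f h" if "i \<in> {1..n}" "\<mu> \<le>o |X|" for i X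
    using represents_color_embedding[OF rep J] that by metis
  obtain h e where
    h: "\<And>i. i \<in> {1..n} \<Longrightarrow> color_embedding (G i) (d i) B f (h i)"
    and cross: "\<And>i j x y. 1 \<le> i \<Longrightarrow> i < j \<Longrightarrow> j \<le> n \<Longrightarrow> x \<in> G i \<Longrightarrow> y \<in> G j \<Longrightarrow>
      h i x \<noteq> h j y \<and> f {h i x, h j y} = e i"
    by (rule end_homogeneous_sequence[where n = n and G = G and d = d, OF \<nu> \<mu> B fin emb];
        (assumption | (rule that; (assumption | simp))))
  \<comment> \<open>The \<open>G i\<close> are disjoint, so each point of their union determines its
    index and the maps \<open>h i\<close> glue.\<close>
  define k where "k x = h (THE i. i \<in> {1..n} \<and> x \<in> G i) x" for x
  have k: "k x = h i x" if "i \<in> {1..n}" "x \<in> G i" for i x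
  proof -
    have "(THE i. i \<in> {1..n} \<and> x \<in> G i) = i"
      using that unique by (intro the_equality) blast+
    then show ?thesis
      by (simp add: k_def)
  qed
  have emb_k: "color_embedding (G i) (d i) B f k" if "i \<in> {1..n}" for i
    using h[OF that] k[OF that] color_embedding_cong by metis
  have k_neq: "k x \<noteq> k y" if "i \<in> {1..n}" "j \<in> {1..n}" "x \<in> G i" "y \<in> G j" "i \<noteq> j" for i j x y
  proof -
    have "i < j \<or> j < i"
      using that(5) by auto
    then have "h i x \<noteq> h j y"
      using that cross by (metis atLeastAtMost_iff)
    then show ?thesis
      using k[OF that(1,3)] k[OF that(2,4)] by simp
  qed
  have "inj_on k ?U"
  proof (rule inj_onI)
    fix x y
    assume "x \<in> ?U" "y \<in> ?U" and eq: "k x = k y"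
    then obtain i j where "i \<in> {1..n}" "x \<in> G i" "j \<in> {1..n}" "y \<in> G j"
      by blast
    then show "x = y"
      using k_neq emb_k eq by (metis color_embedding_def inj_onD)
  qed
  moreover have "k ` ?U \<subseteq> B"
    using emb_k unfolding color_embedding_def by blast
  moreover have "f (k ` p) = f (k ` q)"
    if p: "p \<in> [?U]\<^bsup>2\<^esup>" and q: "q \<in> [?U]\<^bsup>2\<^esup>" and eq: "c p = c q" for p q
  proof -
    \<comment> \<open>By condition (2) a color from the range of \<open>d i\<close> occurs only on
      pairs inside \<open>G i\<close>; as \<open>c p = c q\<close>, one pair inside forces the other
      inside.\<close>
    have inner: "f (k ` p) = f (k ` q)"
      if "i \<in> {1..n}" "p \<in> [G i]\<^bsup>2\<^esup> \<or> q \<in> [G i]\<^bsup>2\<^esup>" for i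
    proof -
      have "p \<in> [G i]\<^bsup>2\<^esup>" "q \<in> [G i]\<^bsup>2\<^esup>"
        using that rng[OF that(1) p] rng[OF that(1) q] eq by auto
      moreover from this have "d i p = d i q"
        using cd that(1) eq by metis
      ultimately show ?thesis
        using emb_k[OF that(1)] unfolding color_embedding_def by blast
    qed
    \<comment> \<open>A crossing pair meets exactly two parts. Listed with the smaller index
      \<open>i\<close> first, it has \<open>Min\<close> equal to \<open>i\<close>, and
      \<open>cross\<close> gives its image the color \<open>e i\<close>.\<close>
    have across: "f (k ` r) = e (Min {j \<in> {1..n}. r \<inter> G j \<noteq> {}})"
      if r: "r \<in> [?U]\<^bsup>2\<^esup> - (\<Union>j \<in> {1..n}. [G j]\<^bsup>2\<^esup>)" for r
    proof -
      have "\<exists>i j x y. i \<in> {1..n} \<and> j \<in> {1..n} \<and> i < j \<and> x \<in> G i \<and> y \<in> G j \<and> r = {x, y}"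
      proof -
        obtain x y where xy: "r = {x, y}" "x \<noteq> y" "x \<in> ?U" "y \<in> ?U"
          using r by (auto simp: nsets_def card_2_iff)
        then obtain i j where ij: "i \<in> {1..n}" "x \<in> G i" "j \<in> {1..n}" "y \<in> G j"
          by blast
        have "i \<noteq> j"
          using r xy ij by (auto simp: nsets_def card_2_iff)
        then show ?thesis
          using xy ij by (metis insert_commute linorder_neqE_nat)
      qed
      then obtain i j x y where *: "i \<in> {1..n}" "j \<in> {1..n}" "i < j" "x \<in> G i" "y \<in> G j" "r = {x, y}"
        by blast
      have "{l \<in> {1..n}. r \<inter> G l \<noteq> {}} = {i, j}"
        using * unique by blast
      then have "Min {l \<in> {1..n}. r \<inter> G l \<noteq> {}} = i"
        using \<open>i < j\<close> by simp
      then show ?thesis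
        using * cross[of i j x y] k[OF *(1,4)] k[OF *(2,5)] by simp
    qed
    show ?thesis
    proof (cases "\<exists>i \<in> {1..n}. p \<in> [G i]\<^bsup>2\<^esup> \<or> q \<in> [G i]\<^bsup>2\<^esup>")
      case True
      then show ?thesis
        using inner by blast
    next
      case False
      then have pq: "p \<in> [?U]\<^bsup>2\<^esup> - (\<Union>j \<in> {1..n}. [G j]\<^bsup>2\<^esup>)" "q \<in> [?U]\<^bsup>2\<^esup> - (\<Union>j \<in> {1..n}. [G j]\<^bsup>2\<^esup>)"
        using p q by auto
      \<comment> \<open>Condition (3) turns equal colors of crossing pairs into equal least indices,
        and by \<open>across\<close> the least index determines the color of the image.\<close>
      show ?thesis
        unfolding across[OF pq(1)] across[OF pq(2)] iffD1[OF outer[OF pq] eq] ..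
    qed
  qed
  ultimately have "color_embedding ?U c B f k"
    unfolding color_embedding_def by blast
  then show ?thesis
    unfolding K_eq by (rule realizes_coloring_identityI)
qed

text \<open>Membership in \<open>identities_of\<close> also asks for a finite identity. A finite
  union of finite \<open>G i\<close> is finite, and having the same color is an equivalence
  relation.\<close>

lemma finite_identity_amalgam:
  assumes "end_homogeneous_amalgam n J K"
  shows "finite_identity K"
proof -
  obtain G d c where "\<forall>i \<in> {1..n}. represents (G i) (d i) (J i)"
    and K: "K = coloring_identity (\<Union>i \<in> {1..n}. G i) c"
    using assms unfolding end_homogeneous_amalgam_def Let_def by blast
  then have "finite (\<Union>i \<in> {1..n}. G i)"
    by (auto simp: represents_def)
  then show ?thesis
    unfolding K finite_identity_def coloring_identity_def
    by (auto intro!: equivI refl_onI symI transI)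
qed

theorem theorem5:
  fixes m :: nat
    and \<kappa> :: "'k rel"
    and \<kappa>' :: "'l rel"
    and \<I> :: "'a identity set"
  assumes "0 < m"
    and "is_aleph m \<kappa>"
    and "is_aleph (m + 1) \<kappa>'"
    and "\<forall>J \<in> \<I>. finite_identity J"
    and "\<I> \<subseteq> identities_of \<kappa>"
  shows "(cl \<I> :: 'b identity set) \<subseteq> identities_of \<kappa>'"
proof
  fix K :: "'b identity"
  assume "K \<in> cl \<I>"
  then obtain n J where J: "\<And>i. i \<in> {1..n} \<Longrightarrow> J i \<in> \<I>" and K: "end_homogeneous_amalgam n J K"
    unfolding cl_def by blast
  \<comment> \<open>Positivity of \<open>m\<close> makes \<open>\<mu>\<close> below the successor of
    an infinite cardinal \<open>\<nu>\<close>, as the color pigeonhole requires.\<close>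
  obtain m' where m: "m = Suc m'"
    using assms(1) gr0_implies_Suc by blast
  obtain \<mu> :: "'l rel" where \<mu>: "is_aleph m \<mu>" "\<kappa>' =o cardSuc \<mu>"
    using assms(3) by auto
  then obtain \<nu> :: "'l rel" where \<nu>: "is_aleph m' \<nu>" "\<mu> =o cardSuc \<nu>"
    using m by auto
  have card: "Card_order \<mu>" "Card_order \<nu>" "Card_order \<kappa>" "Card_order \<kappa>'"
    using is_aleph_Card_order \<mu>(1) \<nu>(1) assms(2,3) by blast+
  have B: "\<mu> <o |Field \<kappa>'|"
    by (rule ordLess_ordIso_trans[OF ordLess_ordIso_trans[OF cardSuc_greater[OF card(1)]
            ordIso_symmetric[OF \<mu>(2)]] ordIso_symmetric[OF card_of_Field_ordIso[OF card(4)]]])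
  \<comment> \<open>\<open>\<kappa>\<close> and \<open>\<mu>\<close> are the same aleph on two
    carrier types; this lets the hypothesis on \<I> be applied to sets over the type of
    \<open>\<kappa>'\<close>.\<close>
  have \<kappa>\<mu>: "|Field \<kappa>| =o \<mu>"
    by (rule ordIso_transitive[OF card_of_Field_ordIso[OF card(3)] is_aleph_unique[OF assms(2) \<mu>(1)]])
  have real: "realizes X f (J i)" if "i \<in> {1..n}" "\<mu> \<le>o |X|" for i f and X :: "'l set"
    by (rule identities_of_realizes[OF subsetD[OF assms(5) J[OF that(1)]] ordIso_ordLeq_trans[OF \<kappa>\<mu> that(2)]])
  have "realizes (Field \<kappa>') f K" for f
    by (rule end_homogeneous_amalgam_realizes[OF card(2) is_aleph_infinite_Field[OF \<nu>(1)] \<nu>(2) B real K])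
  then show "K \<in> identities_of \<kappa>'"
    by (simp add: identities_of_def finite_identity_amalgam[OF K])
qed

end
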